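(* There exists an algorithm which, given query access to any monotone function $f:\{0,1\}^n\to\mathbb{R}$ and an input $x^{\star}\in\{0,1\}^n$, makes $O(C(f)\cdot\log n)$ queries to $f$ and outputs a set $S\subseteq[n]$ of size at most $2C(f)$ that is a certificate for the value $f(x^{\star})$.
   Context: A function $f:\{0,1\}^n\to\mathbb{R}$ is monotone if $x\le y$ coordinatewise implies $f(x)\le f(y)$. For $x\in\{0,1\}^n$ and $S\subseteq[n]$, $x|_S$ denotes the restriction of $x$ to the coordinates in $S$. A set $S\subseteq[n]$ is a certificate for $f$ at $x^{\star}$ if every $y\in\{0,1\}^n$ with $y|_S=x^{\star}|_S$ satisfies $f(y)=f(x^{\star})$. $C(f,x)$ is the minimum size of a certificate for $f$ at $x$, and $C(f)=\max_{x\in\{0,1\}^n}C(f,x)$. A query to $f$ consists of choosing $y\in\{0,1\}^n$ and receiving $f(y)$.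
   Formalization: The query bound is read as O(max(1, C(f)·log n)): when f is constant (C(f)=0) or n ≤ 1 the literal bound is zero queries, which no algorithm can meet, so O(1) queries are allowed there; otherwise the bound is O(C(f)·log n) as stated. *)

theory Defs
  imports Complex_Main "HOL-Library.FuncSet"
begin

text \<open>Points are extensional functions, so the library order on functions, restricted to
  \<open>cube n\<close>, is the coordinatewise order on the coordinates \<open>1, ..., n\<close>; monotonicity of
  a function on the cube is therefore \<open>mono_on (cube n) f\<close>.\<close>

definition cube :: "nat \<Rightarrow> (nat \<Rightarrow> bool) set" where
  "cube n = ({1..n} \<rightarrow>\<^sub>E UNIV)"

definition certificate ::
  "nat \<Rightarrow> ((nat \<Rightarrow> bool) \<Rightarrow> real) \<Rightarrow> (nat \<Rightarrow> bool) \<Rightarrow> nat set \<Rightarrow> bool" where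
  "certificate n f x S \<longleftrightarrow>
     S \<subseteq> {1..n} \<and> (\<forall>y\<in>cube n. restrict y S = restrict x S \<longrightarrow> f y = f x)"

definition cert_size_at :: "nat \<Rightarrow> ((nat \<Rightarrow> bool) \<Rightarrow> real) \<Rightarrow> (nat \<Rightarrow> bool) \<Rightarrow> nat" where
  "cert_size_at n f x = Min (card ` {S. certificate n f x S})"

definition cert_complexity :: "nat \<Rightarrow> ((nat \<Rightarrow> bool) \<Rightarrow> real) \<Rightarrow> nat" where
  "cert_complexity n f = Max (cert_size_at n f ` cube n)"

text \<open>A deterministic adaptive query algorithm is a decision tree whose internal nodes branch on
  the real value returned by the query. The tree is well-founded, so every run halts.\<close>

datatype query_alg =
    Output "nat set"
  | Query "nat \<Rightarrow> bool" "real \<Rightarrow> query_alg"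

primrec output_of :: "((nat \<Rightarrow> bool) \<Rightarrow> real) \<Rightarrow> query_alg \<Rightarrow> nat set" where
  "output_of f (Output S) = S"
| "output_of f (Query y k) = output_of f (k (f y))"

primrec queries_of :: "((nat \<Rightarrow> bool) \<Rightarrow> real) \<Rightarrow> query_alg \<Rightarrow> (nat \<Rightarrow> bool) list" where
  "queries_of f (Output S) = []"
| "queries_of f (Query y k) = y # queries_of f (k (f y))"

text \<open>The quantity inside the \<open>O\<close>. For nonconstant \<open>f\<close> and \<open>n \<ge> 2\<close> it is exactly
  \<open>C(f) * log n\<close>. The maximum with 1 matters only when \<open>C(f) = 0\<close> or \<open>n \<le> 1\<close>, where the
  product is 0: an algorithm that is not told \<open>C(f)\<close> cannot tell a constant function from a
  nonconstant one without making any query.\<close>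

definition query_scale :: "nat \<Rightarrow> ((nat \<Rightarrow> bool) \<Rightarrow> real) \<Rightarrow> real" where
  "query_scale n f = max 1 (real (cert_complexity n f) * log 2 (real n))"

end

theory Submission imports Defs begin

text \<open>With \<open>v = f x\<close>, starting from the set of ones of \<open>x\<close>, find an inclusion-minimal set \<open>S\<close> of
  coordinates such that the indicator of \<open>S\<close> still has value at least \<open>v\<close>. By minimality \<open>f\<close> is
  sensitive at that indicator in every coordinate of \<open>S\<close>, so every certificate there contains \<open>S\<close>
  and \<open>card S \<le> C(f)\<close>. Each element of \<open>S\<close> is found by a binary search, for the shortest prefix of
  the remaining candidates that keeps the value at least \<open>v\<close>; its last element is indispensable.
  Doing the same with the zeros of \<open>x\<close> and upper bounds on \<open>f\<close> gives a second set; by monotonicity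
  the union of the two certifies \<open>f x = v\<close>.\<close>

section \<open>Queries made before a continuation takes over\<close>

text \<open>Decision trees have no sequencing, so the searches below take a continuation. This
  relation separates the queries \<open>qs\<close> of a search from those of the tree
  \<open>b\<close> to which it hands over.\<close>

definition runs_to ::
  "((nat \<Rightarrow> bool) \<Rightarrow> real) \<Rightarrow> query_alg \<Rightarrow> (nat \<Rightarrow> bool) list \<Rightarrow> query_alg \<Rightarrow> bool" where
  "runs_to f a qs b \<longleftrightarrow> output_of f a = output_of f b \<and> queries_of f a = qs @ queries_of f b"

lemma runs_to_refl: "runs_to f a [] a"
  by (simp add: runs_to_def)

lemma runs_to_Query: "runs_to f (k (f y)) qs b \<Longrightarrow> runs_to f (Query y k) (y # qs) b"
  by (simp add: runs_to_def)

lemma runs_to_trans: "runs_to f a qs b \<Longrightarrow> runs_to f b qs' c \<Longrightarrow> runs_to f a (qs @ qs') c"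
  by (simp add: runs_to_def)

section \<open>Binary search for a switching point\<close>

function binary_search ::
  "(nat \<Rightarrow> nat \<Rightarrow> bool) \<Rightarrow> (real \<Rightarrow> bool) \<Rightarrow> (nat \<Rightarrow> query_alg) \<Rightarrow> nat \<Rightarrow> nat \<Rightarrow> query_alg" where
  "binary_search q P k lo hi =
     (if hi \<le> lo + 1 then k hi
      else Query (q ((lo + hi) div 2))
        (\<lambda>r. if P r then binary_search q P k lo ((lo + hi) div 2)
             else binary_search q P k ((lo + hi) div 2) hi))"
  by auto
termination by (relation "measure (\<lambda>(q, P, k, lo, hi). hi - lo)") auto

declare binary_search.simps [simp del]

text \<open>Since \<open>P\<close> fails at \<open>lo\<close> and holds at \<open>hi\<close>, it
  switches on between two neighbours. Testing the midpoint preserves this invariant on one half, so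
  each query lowers \<open>e\<close> by one. The outcomes at the two initial ends are known
  beforehand and cost no query.\<close>

lemma binary_search_runs:
  assumes "lo < hi" "\<not> P (f (q lo))" "P (f (q hi))" "hi - lo \<le> 2 ^ e"
  shows "\<exists>m qs. lo < m \<and> m \<le> hi \<and> \<not> P (f (q (m - 1))) \<and> P (f (q m)) \<and>
           runs_to f (binary_search q P k lo hi) qs (k m) \<and>
           set qs \<subseteq> range q \<and> length qs \<le> e"
  using assms
proof (induction e arbitrary: lo hi)
  case 0
  then have "hi = lo + 1" by simp
  then show ?case
    using 0 by (intro exI[of _ hi] exI[of _ "[]"])
      (simp add: binary_search.simps[of _ _ _ lo] runs_to_refl)
next
  case (Suc e)
  show ?case
  proof (cases "hi \<le> lo + 1")
    case True
    then have "hi = lo + 1" using Suc.prems by simp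
    then show ?thesis
      using Suc.prems by (intro exI[of _ hi] exI[of _ "[]"])
        (simp add: binary_search.simps[of _ _ _ lo] runs_to_refl)
  next
    case False
    define mid where "mid = (lo + hi) div 2"
    \<comment> \<open>Rounding does no harm: the larger half has length
      \<open>(hi - lo + 1) div 2\<close>, and the bound \<open>2 ^ Suc e\<close> is even.\<close>
    have mid: "lo < mid" "mid < hi" "mid - lo \<le> 2 ^ e" "hi - mid \<le> 2 ^ e"
      using False Suc.prems(4) unfolding mid_def by auto
    let ?next = "\<lambda>r. if P r then binary_search q P k lo mid else binary_search q P k mid hi"
    have "\<exists>m qs. lo < m \<and> m \<le> hi \<and> \<not> P (f (q (m - 1))) \<and> P (f (q m)) \<and>
             runs_to f (?next (f (q mid))) qs (k m) \<and> set qs \<subseteq> range q \<and> length qs \<le> e"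
    proof (cases "P (f (q mid))")
      case True
      with Suc.IH[of lo mid] Suc.prems mid show ?thesis by (simp, meson less_imp_le order_trans)
    next
      case False
      with Suc.IH[of mid hi] Suc.prems mid show ?thesis by (simp, meson less_trans)
    qed
    then obtain m qs where m: "lo < m" "m \<le> hi" "\<not> P (f (q (m - 1)))" "P (f (q m))"
      "runs_to f (?next (f (q mid))) qs (k m)" "set qs \<subseteq> range q" "length qs \<le> e"
      by blast
    have "binary_search q P k lo hi = Query (q mid) ?next"
      unfolding mid_def using False by (subst binary_search.simps) simp
    then have "runs_to f (binary_search q P k lo hi) (q mid # qs) (k m)"
      using runs_to_Query[of f ?next "q mid" qs "k m"] m(5) by simp
    then show ?thesis
      using m by (intro exI[of _ m] exI[of _ "q mid # qs"]) auto
  qed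
qed

section \<open>Minimal sets for an upward closed property\<close>

text \<open>The test \<open>0 < j \<and> j \<le> m\<close> always succeeds in a run; it only serves termination.\<close>

function minimize ::
  "(nat set \<Rightarrow> nat \<Rightarrow> bool) \<Rightarrow> (real \<Rightarrow> bool) \<Rightarrow> nat set \<Rightarrow> (nat set \<Rightarrow> query_alg) \<Rightarrow>
     nat \<Rightarrow> nat set \<Rightarrow> query_alg" where
  "minimize pt P Z k m T =
     Query (pt T)
       (\<lambda>r. if P r then k T
            else binary_search (\<lambda>j. pt (T \<union> Z \<inter> {1..j})) P
              (\<lambda>j. if 0 < j \<and> j \<le> m then minimize pt P Z k (j - 1) (insert j T) else k T) 0 m)"
  by auto
termination by (relation "measure (\<lambda>(pt, P, Z, k, m, T). m)") auto

declare minimize.simps [simp del]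

text \<open>\<open>T\<close> collects the elements known to be indispensable; the other candidates
  lie in \<open>Z \<inter> {1..m}\<close>. As the property is upward closed, an element stays
  indispensable when further candidates are discarded. Each new element costs one test of
  \<open>T\<close> and at most \<open>e\<close> search queries; the closing successful test accounts
  for the final 1.\<close>

lemma minimize_runs:
  assumes mono: "\<And>S S'. S \<subseteq> S' \<Longrightarrow> P (f (pt S)) \<Longrightarrow> P (f (pt S'))"
    and "m \<le> 2 ^ e"
    and "P (f (pt (T \<union> Z \<inter> {1..m})))"
    and "T \<inter> {1..m} = {}"
    and "\<And>i. i \<in> T \<Longrightarrow> \<not> P (f (pt (T \<union> Z \<inter> {1..m} - {i})))"
  shows "\<exists>S qs. T \<subseteq> S \<and> S \<subseteq> T \<union> Z \<inter> {1..m} \<and> P (f (pt S)) \<and>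
           (\<forall>i\<in>S. \<not> P (f (pt (S - {i})))) \<and>
           runs_to f (minimize pt P Z k m T) qs (k S) \<and>
           set qs \<subseteq> range pt \<and> length qs \<le> card (S - T) * (e + 1) + 1"
  using assms(2-)
proof (induction m arbitrary: T rule: less_induct)
  case (less m)
  let ?search = "binary_search (\<lambda>j. pt (T \<union> Z \<inter> {1..j})) P
    (\<lambda>j. if 0 < j \<and> j \<le> m then minimize pt P Z k (j - 1) (insert j T) else k T) 0 m"
  show ?case
  proof (cases "P (f (pt T))")
    case True
    have "\<not> P (f (pt (T - {i})))" if "i \<in> T" for i
      using less.prems(4)[OF that] mono[of "T - {i}" "T \<union> Z \<inter> {1..m} - {i}"] by blast
    moreover have "runs_to f (minimize pt P Z k m T) [pt T] (k T)"
      using True by (subst minimize.simps) (intro runs_to_Query, simp add: runs_to_refl)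
    ultimately show ?thesis
      using True by (intro exI[of _ T] exI[of _ "[pt T]"]) auto
  next
    case False
    \<comment> \<open>For \<open>m = 0\<close> the invariant would make \<open>P\<close> hold at
      \<open>T\<close> itself. The search may start at 0, since the empty prefix gives
      \<open>T\<close>, where \<open>P\<close> fails.\<close>
    then have "0 < m" using less.prems(2) by (cases m) auto
    then have "\<exists>j qs. 0 < j \<and> j \<le> m \<and> \<not> P (f (pt (T \<union> Z \<inter> {1..j - 1}))) \<and>
        P (f (pt (T \<union> Z \<inter> {1..j}))) \<and>
        runs_to f ?search qs
          (if 0 < j \<and> j \<le> m then minimize pt P Z k (j - 1) (insert j T) else k T) \<and>
        set qs \<subseteq> range (\<lambda>j. pt (T \<union> Z \<inter> {1..j})) \<and> length qs \<le> e"
      using False less.prems by (intro binary_search_runs) auto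
    then obtain j qs where j: "0 < j" "j \<le> m"
        "\<not> P (f (pt (T \<union> Z \<inter> {1..j - 1})))" "P (f (pt (T \<union> Z \<inter> {1..j})))"
        "runs_to f ?search qs (minimize pt P Z k (j - 1) (insert j T))"
        "set qs \<subseteq> range pt" "length qs \<le> e"
      by (smt (verit) image_subset_iff rangeE rangeI subset_iff)
    have split: "{1..j} = insert j {1..j - 1}" using j(1) by auto
    \<comment> \<open>Otherwise the prefixes up to \<open>j - 1\<close> and \<open>j\<close> would
      give the same set, although \<open>P\<close> distinguishes them.\<close>
    have "j \<in> Z" using j(3,4) unfolding split by (cases "j \<in> Z") auto
    \<comment> \<open>Moving \<open>j\<close> from the candidates to \<open>T\<close> leaves the
      current set unchanged, so the recursive call starts from a set where \<open>P\<close> is known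
      to hold.\<close>
    then have eq: "insert j T \<union> Z \<inter> {1..j - 1} = T \<union> Z \<inter> {1..j}"
      unfolding split by auto
    have "j \<notin> T" using less.prems(3) j(1,2) by auto
    have "\<not> P (f (pt (T \<union> Z \<inter> {1..j} - {i})))" if "i \<in> insert j T" for i
    proof (cases "i = j")
      case True
      then have "T \<union> Z \<inter> {1..j} - {i} \<subseteq> T \<union> Z \<inter> {1..j - 1}" unfolding split by auto
      then show ?thesis using j(3) mono by blast
    next
      case False
      have "T \<union> Z \<inter> {1..j} - {i} \<subseteq> T \<union> Z \<inter> {1..m} - {i}" using j(2) by auto
      then show ?thesis using less.prems(4)[of i] that False mono by blast
    qed
    then obtain S qs' where S: "insert j T \<subseteq> S" "S \<subseteq> T \<union> Z \<inter> {1..j}" "P (f (pt S))"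
        "\<forall>i\<in>S. \<not> P (f (pt (S - {i})))"
        "runs_to f (minimize pt P Z k (j - 1) (insert j T)) qs' (k S)"
        "set qs' \<subseteq> range pt" "length qs' \<le> card (S - insert j T) * (e + 1) + 1"
      using less.IH[of "j - 1" "insert j T", unfolded eq] j(1,2,4) less.prems(1,3) by force
    have "runs_to f ?search (qs @ qs') (k S)"
      using runs_to_trans[OF j(5) S(5)] .
    then have "runs_to f (minimize pt P Z k m T) (pt T # qs @ qs') (k S)"
      using False by (subst minimize.simps) (intro runs_to_Query, simp)
    moreover have "length (pt T # qs @ qs') \<le> card (S - T) * (e + 1) + 1"
    proof -
      have "finite (S - T)" using S(2) by (rule_tac finite_subset[of _ "{1..j}"]) auto
      moreover have "S - T = insert j (S - insert j T)" using S(1) \<open>j \<notin> T\<close> by auto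
      ultimately have "card (S - T) = Suc (card (S - insert j T))"
        by (metis Diff_iff card_insert_disjoint finite_insert insertI1)
      then show ?thesis using S(7) j(7) by simp
    qed
    moreover have "S \<subseteq> T \<union> Z \<inter> {1..m}" using S(2) j(2) by auto
    ultimately show ?thesis
      using S j(6) by (intro exI[of _ S] exI[of _ "pt T # qs @ qs'"]) auto
  qed
qed

section \<open>Sensitive coordinates and certificate size\<close>

lemma finite_cube: "finite (cube n)"
  unfolding cube_def by (intro finite_PiE) auto

text \<open>A certificate at \<open>y\<close> omitting some \<open>i\<close> in \<open>S\<close>
  would also have to cover the neighbour \<open>z\<close>, whose value differs. So even a smallest
  certificate contains \<open>S\<close>.\<close>

lemma card_sensitive_le_cert_complexity:
  assumes y: "y \<in> cube n"
    and sens: "\<And>i. i \<in> S \<Longrightarrow> \<exists>z\<in>cube n. f z \<noteq> f y \<and> (\<forall>j. j \<noteq> i \<longrightarrow> z j = y j)"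
  shows "card S \<le> cert_complexity n f"
proof -
  let ?cards = "card ` {U. certificate n f y U}"
  have "finite {U. certificate n f y U}"
    by (rule finite_subset[of _ "Pow {1..n}"]) (auto simp: certificate_def)
  \<comment> \<open>This makes the set under \<open>Min\<close> nonempty, so that the minimum is
    attained.\<close>
  moreover have "certificate n f y {1..n}"
    using y by (auto simp: certificate_def cube_def PiE_def extensional_restrict)
  ultimately have "cert_size_at n f y \<in> ?cards"
    unfolding cert_size_at_def by (intro Min_in) auto
  then obtain U where U: "certificate n f y U" "cert_size_at n f y = card U" by auto
  have "S \<subseteq> U"
  proof
    fix i assume "i \<in> S"
    then obtain z where z: "z \<in> cube n" "f z \<noteq> f y" "\<forall>j. j \<noteq> i \<longrightarrow> z j = y j"
      using sens by blast
    show "i \<in> U"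
    proof (rule ccontr)
      assume "i \<notin> U"
      then have "restrict z U = restrict y U" using z(3) by (auto simp: fun_eq_iff)
      then show False using U(1) z(1,2) by (auto simp: certificate_def)
    qed
  qed
  then have "card S \<le> cert_size_at n f y"
    using U by (auto simp: certificate_def intro!: card_mono intro: finite_subset)
  also have "\<dots> \<le> cert_complexity n f"
    unfolding cert_complexity_def using y finite_cube by (intro Max_ge) auto
  finally show ?thesis .
qed

section \<open>Points of the cube given by sets of ones or zeros\<close>

definition lower_point :: "nat \<Rightarrow> nat set \<Rightarrow> nat \<Rightarrow> bool" where
  "lower_point n S = restrict (\<lambda>i. i \<in> S) {1..n}"

text \<open>Here \<open>S\<close> lists the zeros, so enlarging \<open>S\<close> lowers the point.
  An upper bound on a monotone \<open>f\<close> is thus upward closed in \<open>S\<close>, and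
  \<open>minimize\<close> serves both directions.\<close>

definition upper_point :: "nat \<Rightarrow> nat set \<Rightarrow> nat \<Rightarrow> bool" where
  "upper_point n S = restrict (\<lambda>i. i \<notin> S) {1..n}"

lemma lower_point_in_cube: "lower_point n S \<in> cube n"
  by (simp add: lower_point_def cube_def)

lemma upper_point_in_cube: "upper_point n S \<in> cube n"
  by (simp add: upper_point_def cube_def)

text \<open>Outside \<open>{1..n}\<close> both points equal \<open>undefined\<close>, so the
  function order compares only the actual coordinates.\<close>

lemma cube_le_iff:
  assumes "x \<in> cube n" "y \<in> cube n"
  shows "x \<le> y \<longleftrightarrow> (\<forall>i\<in>{1..n}. x i \<longrightarrow> y i)"
proof -
  have "x i = y i" if "i \<notin> {1..n}" for i
    using assms that unfolding cube_def by (metis PiE_arb)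
  then show ?thesis unfolding le_fun_def le_bool_def by metis
qed

lemma lower_point_ones:
  assumes "x \<in> cube n"
  shows "lower_point n ({i. x i} \<inter> {1..n}) = x"
  using assms by (fastforce simp: cube_def PiE_iff extensional_def lower_point_def restrict_def)

lemma upper_point_zeros:
  assumes "x \<in> cube n"
  shows "upper_point n ({i. \<not> x i} \<inter> {1..n}) = x"
  using assms by (fastforce simp: cube_def PiE_iff extensional_def upper_point_def restrict_def)

lemma lower_point_mono: "S \<subseteq> S' \<Longrightarrow> lower_point n S \<le> lower_point n S'"
  unfolding cube_le_iff[OF lower_point_in_cube lower_point_in_cube]
  by (simp add: lower_point_def subset_iff)

lemma upper_point_antimono: "S \<subseteq> S' \<Longrightarrow> upper_point n S' \<le> upper_point n S"
  unfolding cube_le_iff[OF upper_point_in_cube upper_point_in_cube]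
  by (simp add: upper_point_def subset_iff) blast

text \<open>A point \<open>y\<close> that agrees with \<open>x\<close> on both sets lies between
  \<open>lower_point n S\<close> and \<open>upper_point n U\<close>, so monotonicity squeezes
  \<open>f y\<close> to \<open>f x\<close>.\<close>

lemma certificate_from_bounds:
  assumes mono: "mono_on (cube n) f" and x: "x \<in> cube n"
    and S: "S \<subseteq> {i. x i} \<inter> {1..n}" "f x \<le> f (lower_point n S)"
    and U: "U \<subseteq> {i. \<not> x i} \<inter> {1..n}" "f (upper_point n U) \<le> f x"
  shows "certificate n f x (S \<union> U)"
  unfolding certificate_def
proof (intro conjI ballI impI)
  show "S \<union> U \<subseteq> {1..n}" using S(1) U(1) by auto
next
  fix y assume y: "y \<in> cube n" and "restrict y (S \<union> U) = restrict x (S \<union> U)"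
  then have agree: "y i = x i" if "i \<in> S \<union> U" for i
    using that by (metis restrict_apply')
  have "lower_point n S \<le> y"
    unfolding cube_le_iff[OF lower_point_in_cube y] using agree S(1) by (auto simp: lower_point_def)
  moreover have "y \<le> upper_point n U"
    unfolding cube_le_iff[OF y upper_point_in_cube] using agree U(1) by (auto simp: upper_point_def)
  ultimately show "f y = f x"
    using S(2) U(2) mono_onD[OF mono lower_point_in_cube y]
      mono_onD[OF mono y upper_point_in_cube] by force
qed

section \<open>The algorithm and its analysis\<close>

definition find_certificate :: "nat \<Rightarrow> (nat \<Rightarrow> bool) \<Rightarrow> query_alg" where
  "find_certificate n x =
     Query x (\<lambda>v. minimize (lower_point n) (\<lambda>r. v \<le> r) {i. x i}
       (\<lambda>S. minimize (upper_point n) (\<lambda>r. r \<le> v) {i. \<not> x i}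
         (\<lambda>U. Output (S \<union> U)) n {}) n {})"

text \<open>The constant 3 is the query of \<open>x\<close> plus the closing test of each of the two
  minimizations.\<close>

lemma find_certificate_runs:
  assumes x: "x \<in> cube n" and mono: "mono_on (cube n) f" and e: "n \<le> 2 ^ e"
  shows "\<exists>S U. output_of f (find_certificate n x) = S \<union> U \<and>
           certificate n f x (S \<union> U) \<and> S \<subseteq> {1..n} \<and> U \<subseteq> {1..n} \<and>
           card S \<le> cert_complexity n f \<and> card U \<le> cert_complexity n f \<and>
           set (queries_of f (find_certificate n x)) \<subseteq> cube n \<and>
           length (queries_of f (find_certificate n x)) \<le> (card S + card U) * (e + 1) + 3"
proof -
  let ?Z0 = "{i. \<not> x i}"
  let ?k0 = "\<lambda>S U. Output (S \<union> U)"
  let ?k1 = "\<lambda>S. minimize (upper_point n) (\<lambda>r. r \<le> f x) ?Z0 (?k0 S) n {}"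
  have "\<exists>S qs. {} \<subseteq> S \<and> S \<subseteq> {} \<union> {i. x i} \<inter> {1..n} \<and> f x \<le> f (lower_point n S) \<and>
           (\<forall>i\<in>S. \<not> f x \<le> f (lower_point n (S - {i}))) \<and>
           runs_to f (minimize (lower_point n) (\<lambda>r. f x \<le> r) {i. x i} ?k1 n {}) qs (?k1 S) \<and>
           set qs \<subseteq> range (lower_point n) \<and> length qs \<le> card (S - {}) * (e + 1) + 1"
  proof (rule minimize_runs[where P = "\<lambda>r. f x \<le> r"])
    fix S S' :: "nat set" assume "S \<subseteq> S'" "f x \<le> f (lower_point n S)"
    then show "f x \<le> f (lower_point n S')"
      using mono_onD[OF mono lower_point_in_cube lower_point_in_cube lower_point_mono]
      by (meson order_trans)
  qed (use lower_point_ones[OF x] e in simp_all)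
  then obtain S qs where S: "S \<subseteq> {i. x i} \<inter> {1..n}" "f x \<le> f (lower_point n S)"
      "\<And>i. i \<in> S \<Longrightarrow> \<not> f x \<le> f (lower_point n (S - {i}))"
      "runs_to f (minimize (lower_point n) (\<lambda>r. f x \<le> r) {i. x i} ?k1 n {}) qs (?k1 S)"
      "set qs \<subseteq> range (lower_point n)" "length qs \<le> card S * (e + 1) + 1"
    by auto
  have "\<exists>U qs. {} \<subseteq> U \<and> U \<subseteq> {} \<union> ?Z0 \<inter> {1..n} \<and> f (upper_point n U) \<le> f x \<and>
           (\<forall>i\<in>U. \<not> f (upper_point n (U - {i})) \<le> f x) \<and>
           runs_to f (?k1 S) qs (?k0 S U) \<and>
           set qs \<subseteq> range (upper_point n) \<and> length qs \<le> card (U - {}) * (e + 1) + 1"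
  proof (rule minimize_runs[where P = "\<lambda>r. r \<le> f x"])
    fix U U' :: "nat set" assume "U \<subseteq> U'" "f (upper_point n U) \<le> f x"
    then show "f (upper_point n U') \<le> f x"
      using mono_onD[OF mono upper_point_in_cube upper_point_in_cube upper_point_antimono]
      by (meson order_trans)
  qed (use upper_point_zeros[OF x] e in simp_all)
  then obtain U qs' where U: "U \<subseteq> ?Z0 \<inter> {1..n}" "f (upper_point n U) \<le> f x"
      "\<And>i. i \<in> U \<Longrightarrow> \<not> f (upper_point n (U - {i})) \<le> f x"
      "runs_to f (?k1 S) qs' (?k0 S U)"
      "set qs' \<subseteq> range (upper_point n)" "length qs' \<le> card U * (e + 1) + 1"
    by auto
  have "runs_to f (find_certificate n x) (x # qs @ qs') (?k0 S U)"
    unfolding find_certificate_def by (intro runs_to_Query runs_to_trans[OF S(4) U(4)])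
  then have run: "output_of f (find_certificate n x) = S \<union> U"
      "queries_of f (find_certificate n x) = x # qs @ qs'"
    by (simp_all add: runs_to_def)
  have "card S \<le> cert_complexity n f"
  proof (rule card_sensitive_le_cert_complexity[OF lower_point_in_cube[of n S]])
    fix i assume "i \<in> S"
    \<comment> \<open>The threshold \<open>f x\<close> is reached at \<open>S\<close> but missed at
      \<open>S - {i}\<close>, so the two values differ; dually for \<open>U\<close> below.\<close>
    with S(2) S(3)[of i]
    show "\<exists>z\<in>cube n. f z \<noteq> f (lower_point n S) \<and> (\<forall>j. j \<noteq> i \<longrightarrow> z j = lower_point n S j)"
      by (intro bexI[of _ "lower_point n (S - {i})"] lower_point_in_cube)
        (auto simp: lower_point_def restrict_def)
  qed
  moreover have "card U \<le> cert_complexity n f"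
  proof (rule card_sensitive_le_cert_complexity[OF upper_point_in_cube[of n U]])
    fix i assume "i \<in> U"
    with U(2) U(3)[of i]
    show "\<exists>z\<in>cube n. f z \<noteq> f (upper_point n U) \<and> (\<forall>j. j \<noteq> i \<longrightarrow> z j = upper_point n U j)"
      by (intro bexI[of _ "upper_point n (U - {i})"] upper_point_in_cube)
        (auto simp: upper_point_def restrict_def)
  qed
  moreover have "set (queries_of f (find_certificate n x)) \<subseteq> cube n"
  proof -
    have "range (lower_point n) \<subseteq> cube n" "range (upper_point n) \<subseteq> cube n"
      using lower_point_in_cube upper_point_in_cube by blast+
    then show ?thesis
      using x subset_trans[OF S(5)] subset_trans[OF U(5)] by (simp add: run(2))
  qed
  moreover have "length (queries_of f (find_certificate n x)) \<le> (card S + card U) * (e + 1) + 3"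
    using S(6) U(6) by (simp add: run(2) algebra_simps)
  moreover have "S \<subseteq> {1..n}" "U \<subseteq> {1..n}" using S(1) U(1) by auto
  moreover have "certificate n f x (S \<union> U)"
    using certificate_from_bounds[OF mono x S(1,2) U(1,2)] .
  ultimately show ?thesis
    by (intro exI[of _ S] exI[of _ U] conjI run(1))
qed

section \<open>The query bound and the final result\<close>

lemma le_two_power_ceiling_log: "n \<le> 2 ^ nat \<lceil>log 2 (real n)\<rceil>"
proof (cases "n = 0")
  case False
  then have "real n = 2 powr log 2 (real n)" by simp
  also have "\<dots> \<le> 2 powr real (nat \<lceil>log 2 (real n)\<rceil>)"
    by (intro powr_mono real_nat_ceiling_ge) auto
  also have "\<dots> = real (2 ^ nat \<lceil>log 2 (real n)\<rceil>)" by (simp add: powr_realpow)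
  finally show ?thesis using of_nat_le_iff by blast
qed simp

text \<open>With \<open>L = log 2 n \<ge> 1\<close>, the rounded factor is at most
  \<open>L + 2 \<le> 3 * L\<close>, giving \<open>6 * C * L\<close>; the additive 3 is absorbed by
  \<open>3 * C * L\<close> as \<open>C * L \<ge> 1\<close>, whence 9. If \<open>C = 0\<close> or
  \<open>n \<le> 1\<close>, the count is at most 5 and the scale is at least 1.\<close>

lemma query_count_le_scale:
  assumes "s \<le> cert_complexity n f" "u \<le> cert_complexity n f" "s \<le> n" "u \<le> n"
  shows "real ((s + u) * (nat \<lceil>log 2 (real n)\<rceil> + 1) + 3) \<le> 9 * query_scale n f"
proof -
  let ?C = "cert_complexity n f" and ?L = "log 2 (real n)"
  consider "?C = 0" | "n \<le> 1" | "?C \<ge> 1" "n \<ge> 2" by linarith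
  then show ?thesis
  proof cases
    case 1
    then show ?thesis using assms by (simp add: query_scale_def)
  next
    case 2
    then consider "n = 0" | "n = 1" by linarith
    then show ?thesis using assms by cases (auto simp: query_scale_def)
  next
    case 3
    then have L: "1 \<le> ?L" by simp
    have "real (nat \<lceil>?L\<rceil> + 1) \<le> 3 * ?L" using L by linarith
    moreover have "real (s + u) \<le> 2 * real ?C" using assms by simp
    ultimately have "real ((s + u) * (nat \<lceil>?L\<rceil> + 1)) \<le> (2 * real ?C) * (3 * ?L)"
      unfolding of_nat_mult by (intro mult_mono) auto
    moreover have "1 \<le> real ?C * ?L"
      using mult_mono[of 1 "real ?C" 1 ?L] 3(1) L by simp
    ultimately show ?thesis by (simp add: query_scale_def)
  qed
qed

theorem theorem1p2:
  "\<exists>(c::real) (A :: nat \<Rightarrow> (nat \<Rightarrow> bool) \<Rightarrow> query_alg).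
     \<forall>n. \<forall>x\<in>cube n. \<forall>f :: (nat \<Rightarrow> bool) \<Rightarrow> real. mono_on (cube n) f \<longrightarrow>
       set (queries_of f (A n x)) \<subseteq> cube n \<and>
       real (length (queries_of f (A n x))) \<le> c * query_scale n f \<and>
       certificate n f x (output_of f (A n x)) \<and>
       card (output_of f (A n x)) \<le> 2 * cert_complexity n f"
proof (intro exI[of _ 9] exI[of _ find_certificate] allI ballI impI)
  fix n x and f :: "(nat \<Rightarrow> bool) \<Rightarrow> real"
  assume "x \<in> cube n" "mono_on (cube n) f"
  then obtain S U where run: "output_of f (find_certificate n x) = S \<union> U"
      "certificate n f x (S \<union> U)" "S \<subseteq> {1..n}" "U \<subseteq> {1..n}"
      "card S \<le> cert_complexity n f" "card U \<le> cert_complexity n f"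
      "set (queries_of f (find_certificate n x)) \<subseteq> cube n"
      "length (queries_of f (find_certificate n x))
         \<le> (card S + card U) * (nat \<lceil>log 2 (real n)\<rceil> + 1) + 3"
    using find_certificate_runs[OF _ _ le_two_power_ceiling_log, of x n f] by auto
  \<comment> \<open>These bounds settle the case \<open>n \<le> 1\<close> of the count, where the
    logarithm vanishes.\<close>
  have "card S \<le> n" "card U \<le> n"
    using card_mono[OF _ run(3)] card_mono[OF _ run(4)] by auto
  then have "real (length (queries_of f (find_certificate n x))) \<le> 9 * query_scale n f"
    using query_count_le_scale[OF run(5,6)] run(8) by linarith
  moreover have "card (S \<union> U) \<le> 2 * cert_complexity n f"
    using card_Un_le[of S U] run(5,6) by linarith
  ultimately show "set (queries_of f (find_certificate n x)) \<subseteq> cube n \<and>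
      real (length (queries_of f (find_certificate n x))) \<le> 9 * query_scale n f \<and>
      certificate n f x (output_of f (find_certificate n x)) \<and>
      card (output_of f (find_certificate n x)) \<le> 2 * cert_complexity n f"
    using run by simp
qed

end
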